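(* Let $G$ be a nontrivial (i.e. $G\neq\{e\}$) compact Hausdorff topological group, and let $P(G)$ be the semigroup of all regular Borel probability measures on $G$ under convolution $\star$. Then $P(G)$ is not a regular semigroup; that is, there exists $\mu\in P(G)$ for which there is no $\nu\in P(G)$ with $\mu\star\nu\star\mu=\mu$.
   Context: $\mathcal{B}$ denotes the $\sigma$-algebra of Borel subsets of $G$, and $e$ is the identity of $G$. $P(G)$ is the set of all regular probability measures on $\mathcal{B}$ (regularity in the usual measure-theoretic sense). For $\mu,\nu\in P(G)$, the convolution $\mu\star\nu\in P(G)$ is defined by $(\mu\star\nu)(A)=\int_G \mu(Ax^{-1})\,d\nu(x)$ for every $A\in\mathcal{B}$; with this product $P(G)$ is a semigroup. For a semigroup $\mathcal{S}$ and $s\in\mathcal{S}$, an element $s^{\dagger}\in\mathcal{S}$ is a generalised inverse of $s$ if $s s^{\dagger} s=s$. A semigroup is called (algebraically) regular if each of its elements has a generalised inverse in the semigroup. *)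

theory Defs
  imports "HOL-Probability.Probability_Measure"
begin

text \<open>
  Groups are written additively, because \<^class>\<open>topological_group_add\<close> is the library's class of
  topological groups.  It does not assume commutativity: \<open>0\<close> is the identity \<open>e\<close>, \<open>x + y\<close> is
  the product \<open>x y\<close>, and \<open>a - x\<close> is \<open>a x\<inverse>\<close>.
\<close>

definition regular_borel_measure :: "'a::topological_space measure \<Rightarrow> bool" where
  "regular_borel_measure M \<longleftrightarrow> sets M = sets borel \<and>
     (\<forall>A\<in>sets borel.
        emeasure M A = (INF U\<in>{U. A \<subseteq> U \<and> open U}. emeasure M U) \<and>
        emeasure M A = (SUP K\<in>{K. K \<subseteq> A \<and> compact K}. emeasure M K))"

definition regular_prob_measures :: "'a::topological_space measure set" where
  "regular_prob_measures = {M. prob_space M \<and> regular_borel_measure M}"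

text \<open>
  Here \<open>(\<lambda>a. a - x) ` A\<close> is the translate \<open>A x\<inverse>\<close>, so the convolution of \<open>M\<close> and \<open>N\<close> sends \<open>A\<close> to
  the integral of \<open>M (A x\<inverse>)\<close> with respect to \<open>N\<close>.  It is not defined as the image of the
  product measure \<open>M \<Otimes>\<^sub>M N\<close> under the group operation: without second countability the
  operation need not be measurable for the product of the two Borel algebras.
\<close>

definition group_convolution ::
    "'a::topological_group_add measure \<Rightarrow> 'a measure \<Rightarrow> 'a measure" where
  "group_convolution M N =
     measure_of UNIV (sets borel) (\<lambda>A. \<integral>\<^sup>+ x. emeasure M ((\<lambda>a. a - x) ` A) \<partial>N)"

lemma space_group_convolution [simp]: "space (group_convolution M N) = UNIV"
  by (simp add: group_convolution_def space_measure_of_conv)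

lemma sets_group_convolution [simp]: "sets (group_convolution M N) = sets borel"
  using sets.sigma_sets_eq[of borel] by (simp add: group_convolution_def sets_measure_of_conv)

lemma translate_in_borel:
  fixes x :: "'a::topological_group_add"
  assumes "A \<in> sets borel"
  shows "(\<lambda>a. a - x) ` A \<in> sets borel"
proof -
  have "(\<lambda>a. a - x) ` A = (\<lambda>a. a + x) -` A \<inter> space borel"
    by (auto simp: image_iff) (metis add_diff_cancel)
  moreover have "(\<lambda>a. a + x) \<in> borel \<rightarrow>\<^sub>M borel"
    by (intro borel_measurable_continuous_onI continuous_intros)
  ultimately show ?thesis
    using assms by (metis measurable_sets)
qed

text \<open>
  The measurability assumption holds for regular finite \<open>M\<close>; it is what makes \<^const>\<open>measure_of\<close>
  return the given set function.
\<close>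

lemma emeasure_group_convolution:
  fixes M N :: "'a::topological_group_add measure"
  assumes M: "sets M = sets borel"
    and meas: "\<And>A. A \<in> sets borel \<Longrightarrow> (\<lambda>x. emeasure M ((\<lambda>a. a - x) ` A)) \<in> borel_measurable N"
    and A: "A \<in> sets borel"
  shows "emeasure (group_convolution M N) A = (\<integral>\<^sup>+ x. emeasure M ((\<lambda>a. a - x) ` A) \<partial>N)"
proof (rule emeasure_measure_of[OF group_convolution_def])
  let ?f = "\<lambda>A. \<integral>\<^sup>+ x. emeasure M ((\<lambda>a. a - x) ` A) \<partial>N"
  show "positive (sets (group_convolution M N)) ?f"
    by (simp add: positive_def)
  show "countably_additive (sets (group_convolution M N)) ?f"
  proof (rule countably_additiveI)
    fix F :: "nat \<Rightarrow> 'a set"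
    assume F: "range F \<subseteq> sets (group_convolution M N)" and disj: "disjoint_family F"
    have FB: "F i \<in> sets borel" for i
      using F by auto
    have "(\<Sum>i. ?f (F i)) = (\<integral>\<^sup>+ x. (\<Sum>i. emeasure M ((\<lambda>a. a - x) ` F i)) \<partial>N)"
      using meas FB by (subst nn_integral_suminf) auto
    also have "\<dots> = ?f (\<Union>i. F i)"
    proof (rule nn_integral_cong)
      fix x
      have "disjoint_family (\<lambda>i. (\<lambda>a. a - x) ` F i)"
        using disj unfolding disjoint_family_on_def disjoint_iff by (auto, metis diff_add_cancel)
      moreover have "range (\<lambda>i. (\<lambda>a. a - x) ` F i) \<subseteq> sets M"
        using translate_in_borel FB M by auto
      ultimately show "(\<Sum>i. emeasure M ((\<lambda>a. a - x) ` F i)) = emeasure M ((\<lambda>a. a - x) ` (\<Union>i. F i))"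
        by (simp add: suminf_emeasure image_UN)
    qed
    finally show "(\<Sum>i. ?f (F i)) = ?f (\<Union>i. F i)" .
  qed
qed (use A in auto)

definition generalised_inverse :: "('s \<Rightarrow> 's \<Rightarrow> 's) \<Rightarrow> 's \<Rightarrow> 's \<Rightarrow> bool" where
  "generalised_inverse f s t \<longleftrightarrow> f (f s t) s = s"

text \<open>\<open>S\<close> is the carrier of the semigroup and \<open>f\<close> its multiplication.\<close>

definition algebraically_regular :: "'s set \<Rightarrow> ('s \<Rightarrow> 's \<Rightarrow> 's) \<Rightarrow> bool" where
  "algebraically_regular S f \<longleftrightarrow> (\<forall>s\<in>S. \<exists>t\<in>S. generalised_inverse f s t)"

end

theory Submission
  imports Defs "HOL-Probability.Probability_Mass_Function"
begin

text \<open>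
  Let \<open>a \<noteq> 0\<close> and let \<open>\<mu>\<close> have mass \<open>2/3\<close> at \<open>0\<close> and \<open>1/3\<close> at \<open>a\<close>.  For every probability measure
  \<open>\<nu>\<close>, the mass of \<open>\<mu> \<star> \<nu> \<star> \<mu>\<close> at \<open>0\<close> is \<open>4/9 \<nu>{0} + 4/9 \<nu>{- a} + 1/9 \<nu>{- a - a}\<close>, which is at most
  \<open>5/9\<close> because \<open>0\<close> and \<open>- a\<close> are distinct.  So it is never \<open>\<mu>{0} = 2/3\<close>.
\<close>

text \<open>\<open>measure_pmf p\<close> makes every set measurable, whereas
  \<open>regular_borel_measure\<close> demands exactly the Borel sets. The \<open>distr\<close>
  along the identity cuts the \<sigma>-algebra down.\<close>

definition borel_pmf :: "'a::topological_space pmf \<Rightarrow> 'a measure" where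
  "borel_pmf p = distr (measure_pmf p) borel (\<lambda>x. x)"

lemma sets_borel_pmf [simp]: "sets (borel_pmf p) = sets borel"
  by (simp add: borel_pmf_def)

lemma prob_space_borel_pmf: "prob_space (borel_pmf p)"
  unfolding borel_pmf_def by (rule measure_pmf.prob_space_distr) simp

lemma emeasure_borel_pmf:
  "A \<in> sets borel \<Longrightarrow> emeasure (borel_pmf p) A = emeasure (measure_pmf p) A"
  by (simp add: borel_pmf_def emeasure_distr)

lemma emeasure_borel_pmf_eqI:
  assumes "A \<in> sets borel" "B \<in> sets borel" "A \<inter> set_pmf p = B \<inter> set_pmf p"
  shows "emeasure (borel_pmf p) A = emeasure (borel_pmf p) B"
  using assms by (metis emeasure_borel_pmf emeasure_Int_set_pmf)

lemma regular_borel_measure_borel_pmf: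
  fixes p :: "'a::t1_space pmf"
  assumes fin: "finite (set_pmf p)"
  shows "regular_borel_measure (borel_pmf p)"
  unfolding regular_borel_measure_def
proof (intro conjI ballI)
  fix A :: "'a set"
  assume A: "A \<in> sets borel"
  have mono: "emeasure (borel_pmf p) B \<le> emeasure (borel_pmf p) C"
    if "B \<subseteq> C" "C \<in> sets borel" for B C
    using that by (intro emeasure_mono) auto
  show "emeasure (borel_pmf p) A = (INF U\<in>{U. A \<subseteq> U \<and> open U}. emeasure (borel_pmf p) U)"
  proof (rule antisym)
    show "emeasure (borel_pmf p) A \<le> (INF U\<in>{U. A \<subseteq> U \<and> open U}. emeasure (borel_pmf p) U)"
      by (rule INF_greatest) (auto intro: mono)
    \<comment> \<open>Deleting the finitely many support points outside \<open>A\<close> leaves an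
      open superset of \<open>A\<close> with no extra mass, so the infimum is attained.\<close>
    let ?U = "- (set_pmf p - A)"
    have U: "open ?U"
      using fin by (intro open_Compl finite_imp_closed) auto
    then have "emeasure (borel_pmf p) A = emeasure (borel_pmf p) ?U"
      using A by (intro emeasure_borel_pmf_eqI) auto
    then show "(INF U\<in>{U. A \<subseteq> U \<and> open U}. emeasure (borel_pmf p) U) \<le> emeasure (borel_pmf p) A"
      using U by (intro INF_lower2[of ?U]) auto
  qed
  show "emeasure (borel_pmf p) A = (SUP K\<in>{K. K \<subseteq> A \<and> compact K}. emeasure (borel_pmf p) K)"
  proof (rule antisym)
    show "(SUP K\<in>{K. K \<subseteq> A \<and> compact K}. emeasure (borel_pmf p) K) \<le> emeasure (borel_pmf p) A"
      using A by (intro SUP_least) (auto intro: mono)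
    \<comment> \<open>Dually, the support points inside \<open>A\<close> form a finite, hence
      compact, set that carries all the mass of \<open>A\<close>.\<close>
    let ?K = "A \<inter> set_pmf p"
    have "closed ?K"
      using fin by (intro finite_imp_closed) auto
    then have "emeasure (borel_pmf p) A = emeasure (borel_pmf p) ?K"
      using A by (intro emeasure_borel_pmf_eqI) auto
    then show "emeasure (borel_pmf p) A \<le> (SUP K\<in>{K. K \<subseteq> A \<and> compact K}. emeasure (borel_pmf p) K)"
      using fin by (intro SUP_upper2[of ?K]) (auto intro: finite_imp_compact)
  qed
qed simp

text \<open>The integrand need not be Borel measurable: it is almost everywhere a simple function.\<close>

lemma nn_integral_borel_pmf:
  fixes p :: "'a::t1_space pmf"
  assumes fin: "finite (set_pmf p)"
  shows "(\<integral>\<^sup>+ x. f x \<partial>borel_pmf p) = (\<integral>\<^sup>+ x. f x \<partial>measure_pmf p)"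
proof -
  define g where "g x = (\<Sum>y\<in>set_pmf p. f y * indicator {y} x)" for x
  have g: "g \<in> borel_measurable borel"
    unfolding g_def by (intro borel_measurable_sum borel_measurable_times_ennreal
        borel_measurable_const borel_measurable_indicator borel_closed) auto
  have fg: "f x = g x" if "x \<in> set_pmf p" for x
    using that fin by (simp add: g_def indicator_def if_distrib sum.delta' cong: if_cong)
  have S: "set_pmf p \<in> sets borel"
    using fin by (intro borel_closed finite_imp_closed)
  have "AE x in borel_pmf p. x \<in> set_pmf p"
    unfolding borel_pmf_def using S by (subst AE_distr_iff) (auto simp: AE_measure_pmf)
  then have "(\<integral>\<^sup>+ x. f x \<partial>borel_pmf p) = (\<integral>\<^sup>+ x. g x \<partial>borel_pmf p)"
    by (intro nn_integral_cong_AE) (auto simp: fg)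
  also have "\<dots> = (\<integral>\<^sup>+ x. g x \<partial>measure_pmf p)"
    unfolding borel_pmf_def using g by (simp add: nn_integral_distr)
  also have "\<dots> = (\<integral>\<^sup>+ x. f x \<partial>measure_pmf p)"
    by (intro nn_integral_cong_AE) (auto simp: fg AE_measure_pmf_iff)
  finally show ?thesis .
qed

lemma emeasure_convolution_borel_pmf_right:
  fixes p :: "'a::{topological_group_add, t1_space} pmf"
  assumes "finite (set_pmf p)" "sets M = sets borel" "A \<in> sets borel"
  shows "emeasure (group_convolution M (borel_pmf p)) A =
    (\<integral>\<^sup>+ x. emeasure M ((\<lambda>a. a - x) ` A) \<partial>measure_pmf p)"
proof -
  \<comment> \<open>Over \<open>measure_pmf p\<close> every function is measurable, so the
    measurability premise of \<open>emeasure_group_convolution\<close> becomes trivial.\<close>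
  have "group_convolution M (borel_pmf p) = group_convolution M (measure_pmf p)"
    using assms(1) by (simp add: group_convolution_def nn_integral_borel_pmf)
  then show ?thesis
    using assms by (simp add: emeasure_group_convolution)
qed

text \<open>By finite support, the mass of the translate is a finite combination of Borel indicators
  in \<open>x\<close>. This gives the measurability that \<open>emeasure_group_convolution\<close>
  requires, and it reduces the exchange of the two integrals to linearity.\<close>

lemma emeasure_convolution_borel_pmf_left:
  fixes p :: "'a::{topological_group_add, t1_space} pmf"
  assumes fin: "finite (set_pmf p)" and N: "sets N = sets borel" and A: "A \<in> sets borel"
  shows "emeasure (group_convolution (borel_pmf p) N) A =
    (\<integral>\<^sup>+ y. emeasure N {x. y + x \<in> A} \<partial>measure_pmf p)"
proof -
  have vim: "{x. y + x \<in> B} \<in> sets N" if "B \<in> sets borel" for B and y :: 'a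
  proof -
    have "(\<lambda>x. y + x) \<in> borel \<rightarrow>\<^sub>M borel"
      by (intro borel_measurable_continuous_onI continuous_intros)
    from measurable_sets[OF this that] show ?thesis
      by (simp add: vimage_def N)
  qed
  have eq: "emeasure (borel_pmf p) ((\<lambda>a. a - x) ` B) =
      (\<Sum>y\<in>set_pmf p. ennreal (pmf p y) * indicator {x. y + x \<in> B} x)"
    if B: "B \<in> sets borel" for B x
  proof -
    have "y \<in> (\<lambda>a. a - x) ` B \<longleftrightarrow> y + x \<in> B" for y
      by (auto simp: image_iff) (metis add_diff_cancel)
    then have ind: "indicator ((\<lambda>a. a - x) ` B) y = (indicator {x. y + x \<in> B} x :: ennreal)" for y
      by (simp add: indicator_def)
    have "emeasure (borel_pmf p) ((\<lambda>a. a - x) ` B) =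
        (\<integral>\<^sup>+ y. indicator ((\<lambda>a. a - x) ` B) y \<partial>measure_pmf p)"
      using translate_in_borel[OF B] by (simp add: emeasure_borel_pmf)
    also have "\<dots> = (\<Sum>y\<in>set_pmf p. ennreal (pmf p y) * indicator {x. y + x \<in> B} x)"
      using fin by (simp only: ind) (simp add: nn_integral_measure_pmf_finite mult.commute)
    finally show ?thesis .
  qed
  have "emeasure (group_convolution (borel_pmf p) N) A =
      (\<integral>\<^sup>+ x. emeasure (borel_pmf p) ((\<lambda>a. a - x) ` A) \<partial>N)"
  proof (rule emeasure_group_convolution[OF _ _ A])
    fix B :: "'a set"
    assume B: "B \<in> sets borel"
    show "(\<lambda>x. emeasure (borel_pmf p) ((\<lambda>a. a - x) ` B)) \<in> borel_measurable N"
      unfolding eq[OF B] using vim[OF B]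
      by (intro borel_measurable_sum borel_measurable_times_ennreal
          borel_measurable_const borel_measurable_indicator)
  qed simp
  also have "\<dots> = (\<Sum>y\<in>set_pmf p. ennreal (pmf p y) * emeasure N {x. y + x \<in> A})"
    unfolding eq[OF A] using vim[OF A]
    by (subst nn_integral_sum) (auto simp: nn_integral_cmult)
  also have "\<dots> = (\<integral>\<^sup>+ y. emeasure N {x. y + x \<in> A} \<partial>measure_pmf p)"
    using fin by (simp add: nn_integral_measure_pmf_finite mult.commute)
  finally show ?thesis .
qed

text \<open>Here \<open>y\<close> comes from the left factor and \<open>x\<close> from the right
  one: the equation \<open>y + n + x = z\<close> has the single solution
  \<open>n = - y + (z - x)\<close>.\<close>

lemma emeasure_sandwich_singleton:
  fixes p :: "'a::{topological_group_add, t1_space} pmf"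
  assumes fin: "finite (set_pmf p)" and N: "sets N = sets borel"
  shows "emeasure (group_convolution (group_convolution (borel_pmf p) N) (borel_pmf p)) {z} =
    (\<integral>\<^sup>+ x. \<integral>\<^sup>+ y. emeasure N {- y + (z - x)} \<partial>measure_pmf p \<partial>measure_pmf p)"
proof -
  have "{x. y + x = w} = {- y + w}" for y w :: 'a
    by (auto simp: add.assoc[symmetric])
  then show ?thesis
    using fin N
    by (simp add: emeasure_convolution_borel_pmf_right emeasure_convolution_borel_pmf_left)
qed

theorem theorem3p3:
  assumes "compact (UNIV :: 'a::{topological_group_add, t2_space} set)"
    and "(UNIV :: 'a set) \<noteq> {0}"
  shows "\<not> algebraically_regular (regular_prob_measures :: 'a measure set) group_convolution"
proof
  assume reg: "algebraically_regular (regular_prob_measures :: 'a measure set) group_convolution"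
  obtain a :: 'a where a: "a \<noteq> 0"
    using assms(2) by auto
  \<comment> \<open>With mass \<open>t\<close> at \<open>0\<close>, the coefficients of \<nu>{0} and
    \<nu>{- a} are \<open>t * t\<close> and \<open>2 * t * (1 - t)\<close>. They coincide, with
    value \<open>4/9\<close>, at \<open>t = 2/3\<close>.\<close>
  define p where "p = map_pmf (\<lambda>b. if b then 0 else a) (bernoulli_pmf (2/3))"
  let ?\<mu> = "borel_pmf p"
  have fin: "finite (set_pmf p)"
    by (simp add: p_def)
  have int: "(\<integral>\<^sup>+ x. f x \<partial>measure_pmf p) = ennreal (2/3) * f 0 + ennreal (1/3) * f a" for f
    by (simp add: p_def mult.commute)
  have "?\<mu> \<in> regular_prob_measures"
    by (simp add: regular_prob_measures_def prob_space_borel_pmf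
        regular_borel_measure_borel_pmf[OF fin])
  with reg obtain \<nu> where \<nu>: "\<nu> \<in> regular_prob_measures"
    and inv: "group_convolution (group_convolution ?\<mu> \<nu>) ?\<mu> = ?\<mu>"
    by (auto simp: algebraically_regular_def generalised_inverse_def)
  interpret \<nu>: prob_space \<nu>
    using \<nu> by (simp add: regular_prob_measures_def)
  have sets_\<nu>: "sets \<nu> = sets borel"
    using \<nu> by (simp add: regular_prob_measures_def regular_borel_measure_def)
  let ?m = "\<lambda>x. measure \<nu> {x}"
  have "emeasure ?\<mu> {0} = (\<integral>\<^sup>+ x. indicator {0} x \<partial>measure_pmf p)"
    by (simp add: emeasure_borel_pmf)
  also have "\<dots> = ennreal (2/3)"
    using a by (simp only: int) simp
  finally have "ennreal (2/3) =
      (\<integral>\<^sup>+ x. \<integral>\<^sup>+ y. emeasure \<nu> {- y + (0 - x)} \<partial>measure_pmf p \<partial>measure_pmf p)"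
    using emeasure_sandwich_singleton[OF fin sets_\<nu>, of 0] by (simp add: inv)
  \<comment> \<open>Both mixed pairs, \<open>x = 0, y = a\<close> and \<open>x = a, y = 0\<close>,
    lead to the point \<open>- a\<close>.\<close>
  also have "\<dots> = ennreal (2/3 * (2/3 * ?m 0 + 1/3 * ?m (- a)) + 1/3 * (2/3 * ?m (- a) + 1/3 * ?m (- a - a)))"
    by (simp only: int \<nu>.emeasure_eq_measure) (simp flip: ennreal_mult ennreal_plus)
  finally have "2/3 = 2/3 * (2/3 * ?m 0 + 1/3 * ?m (- a)) + 1/3 * (2/3 * ?m (- a) + 1/3 * ?m (- a - a))"
    by (subst (asm) ennreal_inj) auto
  moreover have "?m 0 + ?m (- a) \<le> 1"
  proof -
    have "?m 0 + ?m (- a) = measure \<nu> ({0} \<union> {- a})"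
      using a by (intro \<nu>.finite_measure_Union[symmetric]) (auto simp: sets_\<nu>)
    then show ?thesis
      by simp
  qed
  \<comment> \<open>This point equals \<open>0\<close> when \<open>a\<close> has order two, so its
    mass is bounded separately instead of joining the disjoint union.\<close>
  moreover have "?m (- a - a) \<le> 1"
    by simp
  ultimately show False
    by argo
qed

end
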